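(* For every integer $m\ge1$, $$I_{1^-}^m\log\Gamma(0)=\int_{0}^{1}\int_{t_1}^{1}\cdots\int_{t_{m-1}}^{1}\log\Gamma(t_m)\,dt_m\cdots dt_2\,dt_1=\frac{1}{m!}\Big(-\sum_{k=0}^{m-1}\binom{m}{k}\log D_k+\log\pi-\int_{0}^{1}m\,t^{m-1}\log\sin(\pi t)\,dt\Big).$$
   Context: $\Gamma$ is Euler's gamma function and $\log\Gamma(t)$ is the real logarithm for $t\in(0,1]$. The right-sided Riemann-Liouville fractional integral of order $\alpha$ ($\mathfrak{Re}(\alpha)>0$) of $f$ on $[a,b]$ is $I_{b^-}^\alpha f(x)=\frac{1}{\Gamma(\alpha)}\int_x^b (t-x)^{\alpha-1}f(t)\,dt$ for $a\le x<b$; here $a=x=0$, $b=1$, so $I_{1^-}^m\log\Gamma(0)=\frac{1}{(m-1)!}\int_0^1 t^{m-1}\log\Gamma(t)\,dt$. For $m=1$ the repeated integral is $\int_0^1\log\Gamma(t_1)\,dt_1$. Generalized Glaisher constants $D_k>0$, $k=0,1,2,\dots$, are defined by $$\log D_k=\lim_{n\to\infty}\Big(\sum_{m=1}^n m^k\log m-p(n,k)\Big),$$ $$p(n,k)=\frac{n^k\log n}{2}+\frac{n^{k+1}}{k+1}\Big(\log n-\frac{1}{k+1}\Big)+k!\sum_{m=1}^{k}\frac{n^{k-m}B_{m+1}}{(m+1)!(k-m)!}\Big(\log n+(1-\delta_{km})\sum_{l=1}^{m}\frac{1}{k-l+1}\Big)$$ (in these two formulas $m$ is a summation index), where $\delta_{km}$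 is the Kronecker delta, empty sums are $0$, and $B_j$ are the Bernoulli numbers given by $\frac{t}{e^t-1}=\sum_{j\ge0}B_j\frac{t^j}{j!}$ for $|t|<2\pi$. *)

theory Defs
  imports "HOL-Complex_Analysis.Complex_Analysis"
begin

text \<open>The right-sided Riemann--Liouville fractional integral of order \<open>\<alpha>\<close> with \<open>Re \<alpha> > 0\<close>, for
  \<open>x < b\<close>.  At \<open>t = x\<close> the convention \<open>0 powr z = 0\<close> changes the integrand in one point only.\<close>

definition rl_integral_right :: "real \<Rightarrow> complex \<Rightarrow> (real \<Rightarrow> complex) \<Rightarrow> real \<Rightarrow> complex" where
  "rl_integral_right b \<alpha> f x =
     1 / Gamma \<alpha> * integral {x..b} (\<lambda>t. complex_of_real (t - x) powr (\<alpha> - 1) * f t)"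

text \<open>\<open>iterated_integral_right b m f x\<close> is
  \<open>\<integral>\<^sub>x\<^sup>b \<integral>\<^sub>t\<^sub>1\<^sup>b \<dots> \<integral>\<^sub>t\<^sub>m\<^sub>-\<^sub>1\<^sup>b f(t\<^sub>m) dt\<^sub>m \<dots> dt\<^sub>2 dt\<^sub>1\<close>.  The recursion peels off the outermost
  integral, whose variable \<open>t\<^sub>1\<close> is the lower limit of the remaining \<open>m - 1\<close> integrals.\<close>

primrec iterated_integral_right :: "real \<Rightarrow> nat \<Rightarrow> (real \<Rightarrow> real) \<Rightarrow> real \<Rightarrow> real" where
  "iterated_integral_right b 0 f x = f x"
| "iterated_integral_right b (Suc m) f x = integral {x..b} (\<lambda>t. iterated_integral_right b m f t)"

text \<open>Bernoulli numbers, read off from the exponential generating function \<open>t / (e\<^sup>t - 1)\<close>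
  (so \<open>B\<^sub>1 = -1/2\<close>).  The power series identity on \<open>\<bar>t\<bar> < 2\<pi>\<close> is \<open>bernoulli_sums\<close> below.\<close>

definition bernoulli :: "nat \<Rightarrow> real" where
  "bernoulli j = fact j * fps_nth (fps_X / (fps_exp 1 - 1)) j"

lemma bernoulli_sums:
  fixes t :: complex
  assumes "norm t < 2 * pi" "t \<noteq> 0"
  shows "(\<lambda>j. complex_of_real (bernoulli j) * t ^ j / fact j) sums (t / (exp t - 1))"
proof -
  define F :: "real fps" where "F = fps_X / (fps_exp 1 - 1)"
  define E :: "complex fps" where "E = fps_exp 1 - 1"
  define G :: "complex fps" where "G = Abs_fps (\<lambda>n. of_real (fps_nth F n))"
  have nzR: "(fps_exp 1 - 1 :: real fps) \<noteq> 0"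
  proof
    assume "(fps_exp 1 - 1 :: real fps) = 0"
    then have "fps_nth (fps_exp 1 - 1 :: real fps) 1 = 0" by simp
    then show False by simp
  qed
  have sdR: "subdegree (fps_exp 1 - 1 :: real fps) = 1"
    by (rule subdegreeI) auto
  have sdE: "subdegree E = 1"
    unfolding E_def by (rule subdegreeI) auto
  have nzE: "E \<noteq> 0"
    using sdE by auto
  have FE: "F * (fps_exp 1 - 1) = fps_X"
    unfolding F_def using nzR sdR
    by (intro fps_divide_times_eq[THEN trans] dvd_div_mult_self) (auto simp: fps_dvd_iff)
  have "G * E = fps_X"
  proof (rule fps_ext)
    fix n
    have "fps_nth (G * E) n = complex_of_real (fps_nth (F * (fps_exp 1 - 1)) n)"
      by (auto simp: fps_mult_nth G_def E_def intro!: sum.cong)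
    then show "fps_nth (G * E) n = fps_nth fps_X n"
      by (simp add: FE)
  qed
  then have G: "G = fps_X / E"
    using nzE by (metis nonzero_mult_div_cancel_right)
  have ev: "eval_fps E z = exp z - 1" for z
    unfolding E_def by (subst eval_fps_diff) auto
  have nz: "eval_fps E z \<noteq> 0" if "z \<in> eball 0 (ereal (2 * pi))" "z \<noteq> 0" for z
  proof
    assume "eval_fps E z = 0"
    then have "exp z = 1" by (simp add: ev)
    then obtain k :: int where k: "Re z = 0" "Im z = of_int (2 * k) * pi"
      by (auto simp: exp_eq_1)
    have "k \<noteq> 0" using k that(2) by (auto simp: complex_eq_iff)
    then have "1 \<le> \<bar>real_of_int k\<bar>" by linarith
    then have "2 * pi \<le> \<bar>Im z\<bar>" using k by (simp add: abs_mult)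
    also have "\<dots> \<le> norm z" by (rule abs_Im_le_cmod)
    finally show False using that(1) by simp
  qed
  have crE: "fps_conv_radius E = \<infinity>"
  proof -
    have "min (fps_conv_radius (fps_exp (1::complex))) (fps_conv_radius (1::complex fps)) \<le> fps_conv_radius E"
      unfolding E_def by (rule fps_conv_radius_diff)
    then show ?thesis by simp
  qed
  have R: "Min {ereal (2 * pi), fps_conv_radius (fps_X :: complex fps), fps_conv_radius E} = ereal (2 * pi)"
    by (simp add: crE)
  have pos: "0 < ereal (2 * pi)" "0 < fps_conv_radius (fps_X :: complex fps)" "0 < fps_conv_radius E"
    by (simp_all add: crE)
  have sd: "subdegree E \<le> subdegree (fps_X :: complex fps)"
    by (simp add: sdE)
  have rad: "fps_conv_radius G \<ge> ereal (2 * pi)"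
    unfolding G by (rule fps_conv_radius_divide[OF sd pos(2,3,1), unfolded R]) (rule nz)
  have "eval_fps (fps_X / E) t =
    (if t = 0 then fps_nth fps_X (subdegree E) / fps_nth E (subdegree E)
     else eval_fps fps_X t / eval_fps E t)"
    by (rule eval_fps_divide[OF sd pos(2,3,1), unfolded R, OF nz _ refl]) (use assms in auto)
  then have "eval_fps G t = t / (exp t - 1)"
    using assms by (simp add: G ev)
  moreover have "(\<lambda>n. fps_nth G n * t ^ n) sums eval_fps G t"
    using assms(1) by (intro sums_eval_fps less_le_trans[OF _ rad]) simp
  ultimately show ?thesis
    by (simp add: G_def F_def bernoulli_def)
qed

text \<open>In the first sum below \<open>j \<le> k\<close>, and in the second \<open>l \<le> j \<le> k\<close>, so the truncated subtraction
  \<open>k - j\<close> is exact.  The factor \<open>1 - of_bool (k = j)\<close> is \<open>1 - \<delta>\<^sub>k\<^sub>j\<close>.\<close>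

definition glaisher_p :: "nat \<Rightarrow> nat \<Rightarrow> real" where
  "glaisher_p n k =
     real n ^ k * ln (real n) / 2
     + real n ^ (k + 1) / real (k + 1) * (ln (real n) - 1 / real (k + 1))
     + fact k * (\<Sum>j = 1..k. real n ^ (k - j) * bernoulli (j + 1) / (fact (j + 1) * fact (k - j))
         * (ln (real n) + (1 - of_bool (k = j)) * (\<Sum>l = 1..j. 1 / (real k - real l + 1))))"

definition glaisher_D :: "nat \<Rightarrow> real" where
  "glaisher_D k =
     exp (lim (\<lambda>n. (\<Sum>j = 1..n. real j ^ k * ln (real j)) - glaisher_p n k))"

end

theory Submission
  imports Defs "HOL-Real_Asymp.Real_Asymp"
begin

text \<open>
  By the Cauchy formula for repeated integration, \<open>m!\<close> times the iterated integral is
  \<open>\<integral>\<^sub>0\<^sup>1 m t\<^sup>m\<^sup>-\<^sup>1 ln \<Gamma>(t) dt\<close>, and by the reflection formula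
  \<open>\<Gamma>(t) \<Gamma>(1 - t) = \<pi> / sin (\<pi>t)\<close> this equals
  \<open>ln \<pi> - \<integral>\<^sub>0\<^sup>1 m t\<^sup>m\<^sup>-\<^sup>1 ln sin (\<pi>t) dt - \<integral>\<^sub>0\<^sup>1 m t\<^sup>m\<^sup>-\<^sup>1 ln \<Gamma>(1 - t) dt\<close>.  So it remains to show that the
  last integral, which is \<open>\<integral>\<^sub>0\<^sup>1 m (1 - t)\<^sup>m\<^sup>-\<^sup>1 ln \<Gamma>(t) dt\<close>, is
  \<open>\<Sum>\<^bsub>k<m\<^esub> (m choose k) ln D\<^sub>k\<close>.

  Let \<open>B\<^sub>k(x)\<close> be the Bernoulli polynomials.  Since
  \<open>\<Sum>\<^bsub>k<m\<^esub> (m choose k) B\<^sub>k(x) = B\<^sub>m(x + 1) - B\<^sub>m(x) = m x\<^sup>m\<^sup>-\<^sup>1\<close>, this follows, with \<open>x = 1 - t\<close>, from a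
  separate formula for each constant:
  \<open>ln D\<^sub>k = \<integral>\<^sub>0\<^sup>1 B\<^sub>k(1 - t) ln \<Gamma>(t) dt\<close> (lemma \<open>has_integral_refl_bernpoly_ln_Gamma\<close>).

  That formula is an Euler--Maclaurin summation of \<open>x\<^sup>k ln x\<close>, started at \<open>0\<close> and stopped after \<open>k\<close>
  steps.  The derivatives of order less than \<open>k\<close> vanish at \<open>0\<close>, so there is no boundary term at \<open>0\<close>
  that could contribute a constant, and the derivative of order \<open>k\<close> is \<open>k! (ln x + H\<^sub>k)\<close>.  Hence
  the remainder is the integral of \<open>B\<^sub>k(1 - t) \<Sum>\<^bsub>j<n\<^esub> ln (t + j)\<close> over \<open>[0, 1]\<close>, and
  \<open>\<Sum>\<^bsub>j\<le>n\<^esub> j\<^sup>k ln j - p(n, k) = \<integral>\<^sub>0\<^sup>1 B\<^sub>k(1 - t) (t ln n + ln (n - 1)! - \<Sum>\<^bsub>j<n\<^esub> ln (t + j)) dt\<close>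
  holds exactly, for every \<open>n \<ge> 1\<close> (lemma \<open>has_integral_log_product_glaisher\<close>).  The second factor
  of the integrand is the logarithm of Gauss's product for \<open>\<Gamma>(t)\<close>; by log-convexity of \<open>\<Gamma>\<close> it differs
  from \<open>ln \<Gamma>(t)\<close> by at most \<open>1 / n\<close> on \<open>(0, 1]\<close>, so the limit may be taken under the integral.
\<close>

section \<open>Reflected Bernoulli polynomials\<close>

definition bernoulli_egf :: "real fps" where
  "bernoulli_egf = fps_X / (fps_exp 1 - 1)"

lemma bernoulli_conv_egf: "bernoulli k = fact k * fps_nth bernoulli_egf k"
  by (simp add: bernoulli_def bernoulli_egf_def)

lemma bernoulli_egf_times_exp_minus_one: "bernoulli_egf * (fps_exp 1 - 1) = fps_X"
proof -
  have "subdegree (fps_exp 1 - 1 :: real fps) = 1"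
    by (rule subdegreeI) auto
  then show ?thesis
    unfolding bernoulli_egf_def
    by (intro dvd_div_mult_self) (auto simp: fps_dvd_iff)
qed

lemma bernoulli_egf_0: "fps_nth bernoulli_egf 0 = 1"
proof -
  have "fps_nth (bernoulli_egf * (fps_exp 1 - 1)) 1 = 1"
    by (simp add: bernoulli_egf_times_exp_minus_one)
  then show ?thesis
    by (simp add: fps_mult_nth)
qed

lemma bernoulli_egf_1: "fps_nth bernoulli_egf 1 = - 1 / 2"
proof -
  have "fps_nth (bernoulli_egf * (fps_exp 1 - 1)) 2 = 0"
    by (simp add: bernoulli_egf_times_exp_minus_one)
  then show ?thesis
    by (simp add: fps_mult_nth numeral_2_eq_2 bernoulli_egf_0)
qed

lemma DERIV_power_div_fact:
  "((\<lambda>x::real. x ^ Suc d / fact (Suc d)) has_real_derivative x ^ d / fact d) (at x)"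
proof -
  have "real (Suc d) * x ^ d / fact (Suc d) = x ^ d / fact d"
    by (simp add: divide_simps del: of_nat_Suc)
  then show ?thesis
    using DERIV_cdivide[OF DERIV_pow[of "Suc d" x], of "fact (Suc d)"] by simp
qed

text \<open>The polynomial \<open>B\<^sub>k(1 - t) / k!\<close>.  With the argument \<open>1 - t\<close>, the boundary terms of the
  Euler--Maclaurin summation below have the signs of \<open>p(n, k)\<close>; the factor \<open>1 / k!\<close>
  turns differentiation into an index shift.\<close>

definition refl_bernpoly :: "nat \<Rightarrow> real \<Rightarrow> real" where
  "refl_bernpoly k t = fps_nth (bernoulli_egf * fps_exp (1 - t)) k"

lemma refl_bernpoly_altdef:
  "refl_bernpoly k t = (\<Sum>i\<le>k. fps_nth bernoulli_egf i * (1 - t) ^ (k - i) / fact (k - i))"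
  by (simp add: refl_bernpoly_def fps_mult_nth atLeast0AtMost)

lemma refl_bernpoly_0: "refl_bernpoly 0 t = 1"
  by (simp add: refl_bernpoly_altdef bernoulli_egf_0)

lemma refl_bernpoly_at_1: "refl_bernpoly k 1 = fps_nth bernoulli_egf k"
  by (simp add: refl_bernpoly_def)

text \<open>From \<open>F e\<^sup>X = F + X\<close> for \<open>F = X / (e\<^sup>X - 1)\<close>.\<close>

lemma refl_bernpoly_at_0: "refl_bernpoly k 0 = fps_nth bernoulli_egf k + of_bool (k = 1)"
proof -
  have "bernoulli_egf * fps_exp 1 = bernoulli_egf + fps_X"
    using bernoulli_egf_times_exp_minus_one by (simp add: algebra_simps)
  then show ?thesis
    by (simp add: refl_bernpoly_def)
qed

text \<open>The difference equation \<open>B\<^sub>m(x + 1) - B\<^sub>m(x) = m x\<^sup>m\<^sup>-\<^sup>1\<close> at \<open>x = 1 - t\<close>, divided by \<open>m!\<close>: the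
  coefficient of \<open>X\<^sup>m\<close> in \<open>F e\<^sup>x\<^sup>X (e\<^sup>X - 1) = X e\<^sup>x\<^sup>X\<close>.\<close>

lemma refl_bernpoly_sum:
  assumes "m \<ge> 1"
  shows "(\<Sum>k<m. refl_bernpoly k t / fact (m - k)) = (1 - t) ^ (m - 1) / fact (m - 1)"
proof -
  have "bernoulli_egf * fps_exp (1 - t) * (fps_exp 1 - 1) = fps_X * fps_exp (1 - t)"
    by (metis bernoulli_egf_times_exp_minus_one mult.assoc mult.commute)
  then have "fps_nth (bernoulli_egf * fps_exp (1 - t) * (fps_exp 1 - 1)) m = (1 - t) ^ (m - 1) / fact (m - 1)"
    using assms by (simp only: fps_X_mult_nth fps_exp_nth) simp
  moreover have "fps_nth (bernoulli_egf * fps_exp (1 - t) * (fps_exp 1 - 1)) m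
      = (\<Sum>k\<in>{0..m}. refl_bernpoly k t * fps_nth (fps_exp 1 - 1) (m - k))"
    by (simp only: fps_mult_nth[of _ "fps_exp 1 - 1"] refl_bernpoly_def)
  moreover have "\<dots> = (\<Sum>k<m. refl_bernpoly k t / fact (m - k))"
    by (rule sum.mono_neutral_cong_right) auto
  ultimately show ?thesis
    by simp
qed

lemma DERIV_refl_bernpoly [derivative_intros]:
  "(refl_bernpoly (Suc k) has_real_derivative - refl_bernpoly k t) (at t)"
proof -
  have pow: "((\<lambda>t. (1 - t) ^ Suc d / fact (Suc d)) has_real_derivative - ((1 - t) ^ d / fact d)) (at t)" for d
  proof -
    have "((\<lambda>t. 1 - t) has_real_derivative - 1) (at t)"
      by (auto intro!: derivative_eq_intros)
    from DERIV_chain2[OF _ this, OF DERIV_power_div_fact[of d "1 - t"]] show ?thesis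
      by simp
  qed
  have "((\<lambda>t. (\<Sum>i\<le>k. fps_nth bernoulli_egf i * ((1 - t) ^ Suc (k - i) / fact (Suc (k - i))))
          + fps_nth bernoulli_egf (Suc k)) has_real_derivative
        (\<Sum>i\<le>k. fps_nth bernoulli_egf i * - ((1 - t) ^ (k - i) / fact (k - i))) + 0) (at t)"
    by (intro DERIV_add DERIV_sum DERIV_cmult pow DERIV_const)
  also have "(\<lambda>t. (\<Sum>i\<le>k. fps_nth bernoulli_egf i * ((1 - t) ^ Suc (k - i) / fact (Suc (k - i))))
          + fps_nth bernoulli_egf (Suc k)) = refl_bernpoly (Suc k)"
    by (auto simp: fun_eq_iff refl_bernpoly_altdef Suc_diff_le simp del: fact_Suc power_Suc intro!: sum.cong)
  also have "(\<Sum>i\<le>k. fps_nth bernoulli_egf i * - ((1 - t) ^ (k - i) / fact (k - i))) + 0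
      = - refl_bernpoly k t"
    by (simp add: refl_bernpoly_altdef sum_negf)
  finally show ?thesis .
qed

lemma continuous_on_refl_bernpoly [continuous_intros]:
  "continuous_on S f \<Longrightarrow> continuous_on S (\<lambda>x. refl_bernpoly k (f x))"
  unfolding refl_bernpoly_altdef by (auto intro!: continuous_intros)

lemma has_integral_refl_bernpoly:
  assumes "k \<ge> 1"
  shows "(refl_bernpoly k has_integral 0) {0..1}"
proof -
  have "((\<lambda>t. - refl_bernpoly k t) has_integral
      refl_bernpoly (Suc k) 1 - refl_bernpoly (Suc k) 0) {0..1}"
    by (rule fundamental_theorem_of_calculus)
       (auto simp flip: has_real_derivative_iff_has_vector_derivative
             intro: DERIV_refl_bernpoly has_field_derivative_at_within)
  from has_integral_neg[OF this] show ?thesis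
    using assms by (simp add: refl_bernpoly_at_0 refl_bernpoly_at_1)
qed

text \<open>This moment is the source of the term \<open>B\<^sub>k\<^sub>+\<^sub>1 / (k + 1) ln n\<close> of \<open>p(n, k)\<close>, the only one in which the
  constant belonging to \<open>ln n\<close> is left out.\<close>

lemma has_integral_refl_bernpoly_times_id:
  "((\<lambda>t. refl_bernpoly k t * t) has_integral - fps_nth bernoulli_egf (Suc k)) {0..1}"
proof -
  let ?W = "\<lambda>t. - (t * refl_bernpoly (Suc k) t + refl_bernpoly (Suc (Suc k)) t)"
  have "(?W has_real_derivative refl_bernpoly k t * t) (at t within {0..1})" for t
    by (rule has_field_derivative_at_within) (auto intro!: derivative_eq_intros)
  then have "((\<lambda>t. refl_bernpoly k t * t) has_integral ?W 1 - ?W 0) {0..1}"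
    by (intro fundamental_theorem_of_calculus)
       (auto simp flip: has_real_derivative_iff_has_vector_derivative)
  then show ?thesis
    by (simp add: refl_bernpoly_at_0 refl_bernpoly_at_1)
qed

section \<open>Repeated antiderivatives of the logarithm\<close>

text \<open>The antiderivative of order \<open>d\<close> of \<open>ln x + c\<close> that vanishes at \<open>0\<close> (for \<open>d > 0\<close>).  For \<open>c = H\<^sub>k\<close> the
  function with \<open>d = k\<close> is \<open>x\<^sup>k ln x / k!\<close>, so those with
  \<open>d \<le> k + 1\<close> are its derivatives, itself and its antiderivative.\<close>

definition log_monomial :: "real \<Rightarrow> nat \<Rightarrow> real \<Rightarrow> real" where
  "log_monomial c d x = x ^ d / fact d * (ln x + c - harm d)"

lemma log_monomial_0: "log_monomial c 0 x = ln x + c"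
  by (simp add: log_monomial_def harm_expand)

lemma log_monomial_at_0: "d > 0 \<Longrightarrow> log_monomial c d 0 = 0"
  by (simp add: log_monomial_def)

lemma DERIV_log_monomial:
  assumes "x > 0"
  shows "(log_monomial c (Suc d) has_real_derivative log_monomial c d x) (at x)"
proof -
  have L: "((\<lambda>x. ln x + c - harm (Suc d)) has_real_derivative 1 / x) (at x)"
    using assms by (auto intro!: derivative_eq_intros)
  have "((\<lambda>x. x ^ Suc d / fact (Suc d) * (ln x + c - harm (Suc d))) has_real_derivative
     x ^ d / fact d * (ln x + c - harm (Suc d)) + 1 / x * (x ^ Suc d / fact (Suc d))) (at x)"
    by (intro DERIV_mult DERIV_power_div_fact L)
  also have "1 / x * (x ^ Suc d / fact (Suc d)) = x ^ d / fact d * (1 / real (Suc d))"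
    using assms by (simp add: divide_simps del: of_nat_Suc)
  also have "x ^ d / fact d * (ln x + c - harm (Suc d)) + x ^ d / fact d * (1 / real (Suc d))
     = log_monomial c d x"
    unfolding distrib_left[symmetric] log_monomial_def by (simp add: harm_Suc inverse_eq_divide)
  finally show ?thesis
    by (simp add: log_monomial_def[abs_def])
qed

text \<open>Continuity at \<open>0\<close> is what allows the summation to start there.\<close>

lemma continuous_on_log_monomial:
  assumes "d > 0"
  shows "continuous_on {0..} (log_monomial c d)"
proof (subst continuous_on_eq_continuous_within, intro ballI)
  fix x :: real assume "x \<in> {0..}"
  show "continuous (at x within {0..}) (log_monomial c d)"
  proof (cases "x = 0")
    case False
    with \<open>x \<in> {0..}\<close> have "isCont (log_monomial c d) x"
      using assms DERIV_isCont[OF DERIV_log_monomial[of x c "d - 1"]] by simp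
    then show ?thesis
      by (rule continuous_at_imp_continuous_at_within)
  next
    case True
    have "((\<lambda>x::real. x * ln x) \<longlongrightarrow> 0) (at_right 0)"
      by real_asymp
    moreover have "((\<lambda>x::real. x * (c - harm d)) \<longlongrightarrow> 0) (at_right 0)"
      by (auto intro!: tendsto_eq_intros)
    moreover have "((\<lambda>x::real. x ^ (d - 1) / fact d) \<longlongrightarrow> 0 ^ (d - 1) / fact d) (at_right 0)"
      by (intro tendsto_intros) auto
    ultimately have "((\<lambda>x. x ^ (d - 1) / fact d * (x * ln x + x * (c - harm d)))
        \<longlongrightarrow> 0 ^ (d - 1) / fact d * (0 + 0)) (at_right 0)"
      by (intro tendsto_mult tendsto_add)
    also have "(\<lambda>x. x ^ (d - 1) / fact d * (x * ln x + x * (c - harm d))) = log_monomial c d"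
    proof
      fix x :: real
      have "x ^ (d - 1) / fact d * (x * ln x + x * (c - harm d))
          = (x ^ (d - 1) * x) / fact d * (ln x + c - harm d)"
        by (simp add: algebra_simps add_divide_distrib diff_divide_distrib)
      also have "x ^ (d - 1) * x = x ^ d"
        using assms by (cases d) auto
      finally show "x ^ (d - 1) / fact d * (x * ln x + x * (c - harm d)) = log_monomial c d x"
        by (simp add: log_monomial_def)
    qed
    finally show ?thesis
      using assms True
      by (simp add: continuous_within at_within_Ici_at_right log_monomial_at_0)
  qed
qed

section \<open>Euler--Maclaurin summation of powers times logarithms\<close>

text \<open>One step of the summation, on \<open>[j, j + 1]\<close>.  Write \<open>b\<^sub>i\<close> for the reflected polynomials and \<open>G\<^sub>d\<close> for
  the antiderivatives.  Since \<open>b\<^sub>i' = - b\<^sub>i\<^sub>-\<^sub>1\<close> and \<open>G\<^sub>d' = G\<^sub>d\<^sub>-\<^sub>1\<close>, the derivative of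
  \<open>\<Sum>\<^bsub>i\<le>k\<^esub> b\<^sub>i(t) G\<^bsub>k+1-i\<^esub>(t + j)\<close> telescopes to its last term \<open>b\<^sub>k(t) G\<^sub>0(t + j)\<close>.  The endpoint values of
  \<open>b\<^sub>i\<close> agree except for \<open>i = 1\<close>, which leaves the extra summand \<open>G\<^sub>k(j)\<close>.\<close>

lemma has_integral_refl_bernpoly_log_shift:
  assumes "j \<ge> 0"
  shows "((\<lambda>t. refl_bernpoly k t * (ln (t + j) + c)) has_integral
          (\<Sum>i\<le>k. fps_nth bernoulli_egf i *
            (log_monomial c (Suc k - i) (j + 1) - log_monomial c (Suc k - i) j))
          - of_bool (k \<ge> 1) * log_monomial c k j) {0..1}"
proof -
  let ?W = "\<lambda>t. \<Sum>i\<le>k. refl_bernpoly i t * log_monomial c (Suc k - i) (t + j)"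
  have cont: "continuous_on {0..1} ?W"
    using assms by (intro continuous_intros continuous_on_compose2[OF continuous_on_log_monomial]) auto
  have der: "(?W has_real_derivative refl_bernpoly k t * (ln (t + j) + c)) (at t)" if "t > 0" for t
  proof -
    have L: "((\<lambda>t. log_monomial c (Suc d) (t + j)) has_real_derivative log_monomial c d (t + j)) (at t)" for d
    proof -
      have "((\<lambda>t. t + j) has_real_derivative 1) (at t)"
        by (auto intro!: derivative_eq_intros)
      from DERIV_chain2[OF _ this, OF DERIV_log_monomial[of "t + j" c d]] show ?thesis
        using that assms by simp
    qed
    \<comment> \<open>the derivative of the summand with index \<open>i\<close> is \<open>p (i + 1) - p i\<close>\<close>
    define p where "p i = (if i = 0 then 0 else refl_bernpoly (i - 1) t * log_monomial c (Suc k - i) (t + j))" for i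
    have "(?W has_real_derivative (\<Sum>i\<le>k. p (Suc i) - p i)) (at t)"
    proof (rule DERIV_sum)
      fix i assume "i \<in> {..k}"
      then have s: "Suc k - i = Suc (k - i)" by (simp add: Suc_diff_le)
      show "((\<lambda>t. refl_bernpoly i t * log_monomial c (Suc k - i) (t + j)) has_real_derivative p (Suc i) - p i) (at t)"
      proof (cases i)
        case 0
        then show ?thesis
          using DERIV_mult[OF DERIV_const[of 1] L[of k]] by (simp add: p_def refl_bernpoly_0)
      next
        case (Suc i')
        have "((\<lambda>t. refl_bernpoly i t * log_monomial c (Suc (k - i)) (t + j)) has_real_derivative
           (- refl_bernpoly i' t * log_monomial c (Suc (k - i)) (t + j) + log_monomial c (k - i) (t + j) * refl_bernpoly i t)) (at t)"
          unfolding Suc by (intro DERIV_mult DERIV_refl_bernpoly L)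
        then show ?thesis
          unfolding s using Suc s by (simp add: p_def algebra_simps)
      qed
    qed
    also have "(\<Sum>i\<le>k. p (Suc i) - p i) = refl_bernpoly k t * (ln (t + j) + c)"
      by (subst sum_telescope[of p k, symmetric] | simp add: sum_lessThan_telescope flip: lessThan_Suc_atMost)+
         (simp add: p_def log_monomial_0)
    finally show ?thesis .
  qed
  have "((\<lambda>t. refl_bernpoly k t * (ln (t + j) + c)) has_integral ?W 1 - ?W 0) {0..1}"
    using cont der
    by (intro fundamental_theorem_of_calculus_interior)
       (auto simp flip: has_real_derivative_iff_has_vector_derivative)
  also have "?W 1 - ?W 0 = (\<Sum>i\<le>k. fps_nth bernoulli_egf i *
            (log_monomial c (Suc k - i) (j + 1) - log_monomial c (Suc k - i) j)
            - (if i = 1 then log_monomial c k j else 0))"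
    unfolding sum_subtractf[symmetric]
    by (intro sum.cong refl) (auto simp: refl_bernpoly_at_0 refl_bernpoly_at_1 algebra_simps)
  also have "\<dots> = (\<Sum>i\<le>k. fps_nth bernoulli_egf i *
            (log_monomial c (Suc k - i) (j + 1) - log_monomial c (Suc k - i) j))
          - of_bool (k \<ge> 1) * log_monomial c k j"
    by (subst sum_subtractf) (simp add: sum.delta)
  finally show ?thesis .
qed

lemma sum_inverse_conv_harm_diff:
  "j \<le> k \<Longrightarrow> (\<Sum>l = 1..j. 1 / (real k - real l + 1)) = harm k - harm (k - j)"
proof (induction j)
  case (Suc j)
  have "harm (k - j) = harm (k - Suc j) + inverse (real (k - j))"
    using Suc.prems harm_Suc[of "k - Suc j", where 'a = real] by (simp add: Suc_diff_Suc)
  moreover have "real (k - j) = real k - real (Suc j) + 1"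
    using Suc.prems by (simp add: of_nat_diff)
  ultimately show ?case
    using Suc by (simp add: inverse_eq_divide)
qed simp

text \<open>The polynomial part \<open>p(n, k)\<close> is the boundary sum of the Euler--Maclaurin summation: up to the
  factor \<open>k!\<close>, the terms \<open>i = 0\<close> and \<open>i = 1\<close> (with \<open>n\<^sup>k ln n / k!\<close> added) are its first two
  terms, and the term \<open>i = j + 1\<close> is the summand \<open>j < k\<close>.  The summand \<open>j = k\<close> stands apart because
  of its Kronecker delta.\<close>

lemma glaisher_p_conv_log_monomial:
  assumes "k \<ge> 1"
  shows "glaisher_p n k / fact k =
     (\<Sum>i\<le>k. fps_nth bernoulli_egf i * log_monomial (harm k) (Suc k - i) (real n))
     + real n ^ k * ln (real n) / fact k + fps_nth bernoulli_egf (Suc k) * ln (real n)"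
proof -
  let ?L = "ln (real n)"
  define T where "T j = real n ^ (k - j) * bernoulli (j + 1) / (fact (j + 1) * fact (k - j))
         * (?L + (1 - of_bool (k = j)) * (\<Sum>l = 1..j. 1 / (real k - real l + 1)))" for j
  let ?U = "\<lambda>i. fps_nth bernoulli_egf i * log_monomial (harm k) (Suc k - i) (real n)"
  have T: "T j = ?U (Suc j)" if "j \<in> {1..<k}" for j
  proof -
    have "(\<Sum>l = 1..j. 1 / (real k - real l + 1)) = harm k - harm (k - j)"
      using that by (intro sum_inverse_conv_harm_diff) auto
    then show ?thesis
      using that by (simp add: T_def bernoulli_conv_egf log_monomial_def add_diff_eq mult_ac
          del: fact_Suc sum.cl_ivl_Suc)
  qed
  have Tk: "T k = fps_nth bernoulli_egf (Suc k) * ?L"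
    by (simp add: T_def bernoulli_conv_egf del: fact_Suc)
  have "{1..k} = insert k {1..<k}"
    using assms by auto
  then have "(\<Sum>j = 1..k. T j) = T k + (\<Sum>j = 1..<k. T j)"
    by simp
  also have "(\<Sum>j = 1..<k. T j) = (\<Sum>j = 1..<k. ?U (Suc j))"
    by (intro sum.cong T) auto
  also have "\<dots> = (\<Sum>i = Suc 1..<Suc k. ?U i)"
    by (rule sum.shift_bounds_Suc_ivl[symmetric])
  finally have 1: "(\<Sum>j = 1..k. T j) = fps_nth bernoulli_egf (Suc k) * ?L + (\<Sum>i = Suc 1..<Suc k. ?U i)"
    by (simp add: Tk)
  have "(\<Sum>i\<le>k. ?U i) = (\<Sum>i = 0..<Suc k. ?U i)"
    by (intro sum.cong) auto
  also have "\<dots> = ?U 0 + (?U 1 + (\<Sum>i = Suc 1..<Suc k. ?U i))"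
    using assms by (simp add: sum.atLeast_Suc_lessThan del: sum.op_ivl_Suc)
  finally have 2: "(\<Sum>i\<le>k. ?U i) = ?U 0 + (?U 1 + (\<Sum>i = Suc 1..<Suc k. ?U i))" .
  have U0: "?U 0 = real n ^ (k + 1) / real (k + 1) * (?L - 1 / real (k + 1)) / fact k"
    by (simp add: bernoulli_egf_0 log_monomial_def harm_Suc inverse_eq_divide divide_simps)
       (simp add: algebra_simps)
  have U1: "?U 1 = - (real n ^ k * ?L / fact k) / 2"
    using bernoulli_egf_1 by (simp add: log_monomial_def)
  have "glaisher_p n k / fact k = (real n ^ k * ?L / 2) / fact k
      + real n ^ (k + 1) / real (k + 1) * (?L - 1 / real (k + 1)) / fact k
      + (\<Sum>j = 1..k. T j)"
    unfolding glaisher_p_def T_def[symmetric] by (simp add: add_divide_distrib)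
  then show ?thesis
    unfolding 1 2 U0 U1 by simp
qed

text \<open>Summing the steps over \<open>j < n\<close>, the boundary sums telescope.  For \<open>k \<ge> 1\<close> constants integrate to
  \<open>0\<close> against the Bernoulli polynomial, so \<open>H\<^sub>k\<close> and \<open>ln (n - 1)!\<close> drop out; for \<open>k = 0\<close> one has
  \<open>H\<^sub>0 = 0\<close>, and \<open>ln (n - 1)!\<close> supplies the sum of the logarithms.\<close>

lemma has_integral_log_product_glaisher:
  assumes "n \<ge> 1"
  shows "((\<lambda>t. refl_bernpoly k t * (t * ln (real n) + ln (fact (n - 1)) - (\<Sum>j<n. ln (t + real j))))
    has_integral ((\<Sum>j = 1..n. real j ^ k * ln (real j)) - glaisher_p n k) / fact k) {0..1}"
proof -
  define V where "V x = (\<Sum>i\<le>k. fps_nth bernoulli_egf i * log_monomial (harm k) (Suc k - i) x)" for x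
  have V0: "V 0 = 0"
    unfolding V_def by (intro sum.neutral) (auto simp: log_monomial_at_0)
  have lk: "log_monomial (harm k) k x = x ^ k * ln x / fact k" for x
    by (simp add: log_monomial_def)
  have "((\<lambda>t. \<Sum>j<n. refl_bernpoly k t * (ln (t + real j) + harm k)) has_integral
     (\<Sum>j<n. (V (real (Suc j)) - V (real j)) - of_bool (k \<ge> 1) * log_monomial (harm k) k (real j))) {0..1}"
  proof (intro has_integral_sum)
    fix j
    show "((\<lambda>t. refl_bernpoly k t * (ln (t + real j) + harm k)) has_integral
       (V (real (Suc j)) - V (real j)) - of_bool (k \<ge> 1) * log_monomial (harm k) k (real j)) {0..1}"
      using has_integral_refl_bernpoly_log_shift[of "real j" k "harm k"]
      by (simp add: V_def right_diff_distrib sum_subtractf add.commute)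
  qed auto
  also have "(\<Sum>j<n. (V (real (Suc j)) - V (real j)) - of_bool (k \<ge> 1) * log_monomial (harm k) k (real j))
     = V (real n) - of_bool (k \<ge> 1) * (\<Sum>j<n. real j ^ k * ln (real j) / fact k)"
    using sum_lessThan_telescope[of "\<lambda>j. V (real j)" n] V0
    by (simp add: sum_subtractf sum_distrib_left lk)
  finally have logs: "((\<lambda>t. \<Sum>j<n. refl_bernpoly k t * (ln (t + real j) + harm k)) has_integral
     V (real n) - of_bool (k \<ge> 1) * (\<Sum>j<n. real j ^ k * ln (real j) / fact k)) {0..1}" .
  have const: "(refl_bernpoly k has_integral of_bool (k = 0)) {0..1}"
    using has_integral_refl_bernpoly[of k] has_integral_const_real[of "1::real" 0 1]
    by (cases "k = 0") (auto simp: refl_bernpoly_0[abs_def])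
  have S: "(\<Sum>j = 1..n. real j ^ k * ln (real j)) = (\<Sum>j<n. real j ^ k * ln (real j)) + real n ^ k * ln (real n)"
  proof -
    have "(\<Sum>j = 1..n. real j ^ k * ln (real j)) = (\<Sum>j\<le>n. real j ^ k * ln (real j))"
      by (intro sum.mono_neutral_left) (auto simp: not_le less_Suc_eq)
    then show ?thesis
      by (simp flip: lessThan_Suc_atMost)
  qed
  have "((\<lambda>t. ln (real n) * (refl_bernpoly k t * t)
        + (ln (fact (n - 1)) + real n * harm k) * refl_bernpoly k t
        - (\<Sum>j<n. refl_bernpoly k t * (ln (t + real j) + harm k))) has_integral
      ln (real n) * - fps_nth bernoulli_egf (Suc k) + (ln (fact (n - 1)) + real n * harm k) * of_bool (k = 0)
      - (V (real n) - of_bool (k \<ge> 1) * (\<Sum>j<n. real j ^ k * ln (real j) / fact k))) {0..1}"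
    by (intro has_integral_add has_integral_diff has_integral_mult_right
        has_integral_refl_bernpoly_times_id const logs)
  also have "(\<lambda>t. ln (real n) * (refl_bernpoly k t * t)
        + (ln (fact (n - 1)) + real n * harm k) * refl_bernpoly k t
        - (\<Sum>j<n. refl_bernpoly k t * (ln (t + real j) + harm k)))
     = (\<lambda>t. refl_bernpoly k t * (t * ln (real n) + ln (fact (n - 1)) - (\<Sum>j<n. ln (t + real j))))"
    by (simp add: fun_eq_iff algebra_simps sum.distrib flip: sum_distrib_left)
  also have "ln (real n) * - fps_nth bernoulli_egf (Suc k) + (ln (fact (n - 1)) + real n * harm k) * of_bool (k = 0)
      - (V (real n) - of_bool (k \<ge> 1) * (\<Sum>j<n. real j ^ k * ln (real j) / fact k))
     = ((\<Sum>j = 1..n. real j ^ k * ln (real j)) - glaisher_p n k) / fact k"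
  proof (cases "k = 0")
    case False
    then show ?thesis
      unfolding diff_divide_distrib S using glaisher_p_conv_log_monomial[of k n]
      by (simp add: V_def add_divide_distrib sum_divide_distrib)
  next
    case True
    have "ln (fact n) = (\<Sum>j = 1..n. ln (real j))"
      by (simp add: fact_prod of_nat_prod) (subst ln_prod, auto)
    moreover have "ln (fact n :: real) = ln (real n) + ln (fact (n - 1))"
      using assms by (simp add: fact_reduce[of n] ln_mult)
    ultimately show ?thesis
      using True bernoulli_egf_1
      by (simp add: glaisher_p_def V_def bernoulli_egf_0 log_monomial_def harm_expand algebra_simps)
  qed
  finally show ?thesis .
qed

section \<open>Gauss's product for the Gamma function\<close>

lemma log_product_conv_ln_Gamma:
  fixes t :: real
  assumes "t > 0" "n \<ge> 1"
  shows "t * ln (real n) + ln (fact (n - 1)) - (\<Sum>j<n. ln (t + real j))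
     = ln (Gamma t) + (t * ln (real n) + ln (Gamma (real n)) - ln (Gamma (t + real n)))"
proof -
  have "t \<notin> \<int>\<^sub>\<le>\<^sub>0"
    using assms by (auto elim!: nonpos_Ints_cases)
  then have "ln (Gamma (t + real n) / Gamma t) = ln (pochhammer t n)"
    by (simp add: pochhammer_Gamma)
  also have "\<dots> = (\<Sum>j<n. ln (t + real j))"
    unfolding pochhammer_prod atLeast0LessThan using assms by (subst ln_prod) (auto simp: add_pos_nonneg)
  finally have "ln (Gamma (t + real n)) - ln (Gamma t) = (\<Sum>j<n. ln (t + real j))"
    using assms by (simp add: ln_divide_pos add_pos_nonneg)
  moreover have "Gamma (real n) = fact (n - 1)"
    using assms Gamma_fact[of "n - 1", where 'a = real] by (simp add: of_nat_diff)
  ultimately show ?thesis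
    by simp
qed

lemma ln_Gamma_plus1:
  fixes x :: real
  assumes "x > 0"
  shows "ln (Gamma (x + 1)) = ln x + ln (Gamma x)"
proof -
  have "x \<notin> \<int>\<^sub>\<le>\<^sub>0"
    using assms by (auto elim!: nonpos_Ints_cases)
  then show ?thesis
    using assms by (simp add: Gamma_plus1 ln_mult_pos mult.commute)
qed

lemma continuous_on_ln_Gamma: "continuous_on {0<..} (\<lambda>t::real. ln (Gamma t))"
  by (auto intro!: continuous_intros simp: Gamma_eq_zero_iff elim!: nonpos_Ints_cases)

text \<open>Log-convexity between \<open>n\<close> and \<open>n + 1\<close> bounds \<open>ln \<Gamma>(n + t)\<close> above; placing \<open>n + 1\<close> between
  \<open>n + t\<close> and \<open>n + t + 1\<close> bounds it below.\<close>

lemma ln_Gamma_shift_error: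
  fixes t :: real
  assumes "t \<in> {0..1}" "n \<ge> 1"
  shows "\<bar>t * ln (real n) + ln (Gamma (real n)) - ln (Gamma (t + real n))\<bar> \<le> 1 / real n"
proof -
  have conv: "ln (Gamma ((1 - u) * x + u * y)) \<le> (1 - u) * ln (Gamma x) + u * ln (Gamma y)"
    if "u \<in> {0..1}" "x > 0" "y > 0" for u x y :: real
    using convex_onD[OF log_convex_Gamma_real, of u x y] that by simp
  have n: "real n > 0" "t + real n > 0"
    using assms by auto
  have "ln (Gamma (t + real n)) \<le> (1 - t) * ln (Gamma (real n)) + t * ln (Gamma (real n + 1))"
    using conv[of t "real n" "real n + 1"] assms by (simp add: algebra_simps)
  then have lower: "ln (Gamma (t + real n)) \<le> ln (Gamma (real n)) + t * ln (real n)"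
    unfolding ln_Gamma_plus1[OF n(1)] by (simp add: algebra_simps)
  have "ln (Gamma (real n + 1)) \<le> t * ln (Gamma (t + real n)) + (1 - t) * ln (Gamma ((t + real n) + 1))"
    using conv[of "1 - t" "t + real n" "(t + real n) + 1"] assms by (simp add: algebra_simps)
  then have "ln (real n) + ln (Gamma (real n)) \<le> ln (Gamma (t + real n)) + (1 - t) * ln (t + real n)"
    unfolding ln_Gamma_plus1[OF n(1)] ln_Gamma_plus1[OF n(2)] by (simp add: algebra_simps)
  then have "t * ln (real n) + ln (Gamma (real n)) - ln (Gamma (t + real n))
      \<le> (1 - t) * (ln (t + real n) - ln (real n))"
    by (simp add: algebra_simps)
  also have "ln (t + real n) - ln (real n) = ln (1 + t / real n)"
    using n by (simp add: ln_divide_pos[symmetric] add_divide_distrib add.commute)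
  also have "(1 - t) * \<dots> \<le> 1 * (t / real n)"
    using assms by (intro mult_mono ln_add_one_self_le_self) auto
  also have "\<dots> \<le> 1 / real n"
    using assms by (simp add: divide_right_mono)
  finally show ?thesis
    using lower by simp
qed

section \<open>Glaisher constants as integrals of the log-Gamma function\<close>

text \<open>The integrand \<open>ln \<Gamma>\<close> is unbounded at \<open>0\<close>; its integrability against the Bernoulli polynomial comes
  from the exact identity at \<open>n = 1\<close>, which differs from it by a continuous function.\<close>

lemma has_integral_refl_bernpoly_ln_Gamma:
  "((\<lambda>t. refl_bernpoly k t * ln (Gamma t)) has_integral ln (glaisher_D k) / fact k) {0..1}"
proof -
  define J where "J = integral {0..1} (\<lambda>t. refl_bernpoly k t * ln (Gamma t))"
  define s where "s n = (\<Sum>j = 1..n. real j ^ k * ln (real j)) - glaisher_p n k" for n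
  define e where "e n t = t * ln (real n) + ln (Gamma (real n)) - ln (Gamma (t + real n))" for n and t :: real
  have e_int: "(\<lambda>t. refl_bernpoly k t * e n t) integrable_on {0..1}" if "n \<ge> 1" for n
  proof (intro integrable_continuous_real continuous_intros)
    show "continuous_on {0..1} (e n)"
    proof -
      have "continuous_on {0..1} (\<lambda>t. ln (Gamma (t + real n)))"
        using that
        by (intro continuous_on_compose2[OF continuous_on_ln_Gamma, where f = "\<lambda>t. t + real n"]
            continuous_intros) auto
      then show ?thesis
        unfolding e_def
        by (intro continuous_on_diff continuous_on_add continuous_on_mult continuous_on_const continuous_on_id)
    qed
  qed
  have diff: "((\<lambda>t. refl_bernpoly k t * ln (Gamma t)) has_integral
      s n / fact k - integral {0..1} (\<lambda>t. refl_bernpoly k t * e n t)) {0..1}" if n: "n \<ge> 1" for n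
  proof (rule has_integral_spike_finite[of "{0}"])
    show "((\<lambda>t. refl_bernpoly k t * (t * ln (real n) + ln (fact (n - 1)) - (\<Sum>j<n. ln (t + real j)))
        - refl_bernpoly k t * e n t) has_integral
      s n / fact k - integral {0..1} (\<lambda>t. refl_bernpoly k t * e n t)) {0..1}"
      unfolding s_def
      by (intro has_integral_diff has_integral_log_product_glaisher integrable_integral e_int n)
    show "refl_bernpoly k t * ln (Gamma t) =
        refl_bernpoly k t * (t * ln (real n) + ln (fact (n - 1)) - (\<Sum>j<n. ln (t + real j)))
        - refl_bernpoly k t * e n t" if "t \<in> {0..1} - {0}" for t
    proof -
      have "t * ln (real n) + ln (fact (n - 1)) - (\<Sum>j<n. ln (t + real j)) = ln (Gamma t) + e n t"
        unfolding e_def using that n by (intro log_product_conv_ln_Gamma) auto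
      then show ?thesis
        by (simp only: distrib_left add_diff_cancel_right')
    qed
  qed auto
  have J: "((\<lambda>t. refl_bernpoly k t * ln (Gamma t)) has_integral J) {0..1}"
    using diff[of 1] by (simp add: J_def has_integral_integral[symmetric] has_integral_integrable)
  have "compact (refl_bernpoly k ` {0..1})"
    by (intro compact_continuous_image continuous_intros) auto
  then obtain C where C: "C > 0" "\<And>t. t \<in> {0..1} \<Longrightarrow> \<bar>refl_bernpoly k t\<bar> \<le> C"
    using compact_imp_bounded bounded_pos by (metis (no_types, lifting) image_eqI real_norm_def)
  \<comment> \<open>the error is at most the sup norm of the polynomial times the log-convexity bound\<close>
  have "\<bar>s n / fact k - J\<bar> \<le> C / real n" if n: "n \<ge> 1" for n
  proof -
    have "s n / fact k - J = integral {0..1} (\<lambda>t. refl_bernpoly k t * e n t)"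
      using has_integral_unique[OF J diff[OF n]] by simp
    moreover have "norm (integral {0..1} (\<lambda>t. refl_bernpoly k t * e n t)) \<le> C * (1 / real n) * measure lborel {0..1::real}"
    proof (rule has_integral_bound_real[where S = "{}", OF _ _ integrable_integral[OF e_int[OF n]]])
      show "norm (refl_bernpoly k t * e n t) \<le> C * (1 / real n)" if "t \<in> {0..1} - {}" for t
        unfolding real_norm_def abs_mult e_def using that C n
        by (intro mult_mono ln_Gamma_shift_error) auto
    qed (use C in auto)
    ultimately show ?thesis
      by simp
  qed
  then have "\<forall>\<^sub>F n in sequentially. norm (s n / fact k - J) \<le> C / real n"
    by (intro eventually_sequentiallyI[of 1]) simp
  moreover have "(\<lambda>n. C / real n) \<longlonglongrightarrow> 0"
    by real_asymp
  ultimately have "(\<lambda>n. s n / fact k - J) \<longlonglongrightarrow> 0"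
    by (rule Lim_null_comparison)
  then have "(\<lambda>n. s n / fact k) \<longlonglongrightarrow> J"
    by (simp add: LIM_zero_iff)
  from tendsto_mult_right[OF this, of "fact k"] have "s \<longlonglongrightarrow> J * fact k"
    by (simp add: mult.commute)
  then have "ln (glaisher_D k) = J * fact k"
    unfolding glaisher_D_def s_def[symmetric] by (simp add: limI)
  with J show ?thesis
    by simp
qed

text \<open>Combining the integrals for \<open>k < m\<close> with binomial weights turns the Bernoulli polynomials into
  \<open>m (1 - t)\<^sup>m\<^sup>-\<^sup>1\<close>; then \<open>t\<close> is replaced by \<open>1 - t\<close>.\<close>

lemma has_integral_power_ln_Gamma_complement:
  assumes "m \<ge> 1"
  shows "((\<lambda>t. real m * t ^ (m - 1) * ln (Gamma (1 - t))) has_integral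
      (\<Sum>k = 0..m - 1. real (m choose k) * ln (glaisher_D k))) {0..1}"
proof -
  have "((\<lambda>t. fact m * (\<Sum>k<m. refl_bernpoly k t * ln (Gamma t) / fact (m - k))) has_integral
      fact m * (\<Sum>k<m. ln (glaisher_D k) / fact k / fact (m - k))) {0..1}"
    by (intro has_integral_mult_right has_integral_sum has_integral_divide
        has_integral_refl_bernpoly_ln_Gamma) auto
  also have "(\<lambda>t. fact m * (\<Sum>k<m. refl_bernpoly k t * ln (Gamma t) / fact (m - k)))
      = (\<lambda>t. real m * (1 - t) ^ (m - 1) * ln (Gamma t))"
  proof
    fix t
    have "fact m * (\<Sum>k<m. refl_bernpoly k t * ln (Gamma t) / fact (m - k))
        = fact m * (\<Sum>k<m. refl_bernpoly k t / fact (m - k)) * ln (Gamma t)"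
      by (simp add: sum_distrib_right)
    also have "\<dots> = real m * (1 - t) ^ (m - 1) * ln (Gamma t)"
      using assms by (simp add: refl_bernpoly_sum fact_reduce[of m])
    finally show "fact m * (\<Sum>k<m. refl_bernpoly k t * ln (Gamma t) / fact (m - k))
        = real m * (1 - t) ^ (m - 1) * ln (Gamma t)" .
  qed
  also have "fact m * (\<Sum>k<m. ln (glaisher_D k) / fact k / fact (m - k))
      = (\<Sum>k = 0..m - 1. real (m choose k) * ln (glaisher_D k))"
    unfolding sum_distrib_left using assms
    by (intro sum.cong) (auto simp: binomial_fact)
  finally have "((\<lambda>t. real m * (1 - t) ^ (m - 1) * ln (Gamma t)) has_integral
      (\<Sum>k = 0..m - 1. real (m choose k) * ln (glaisher_D k))) (cbox 0 1)"
    by simp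
  from has_integral_affinity[OF this, of "-1" 1] show ?thesis
    by (simp add: image_affinity_atLeastAtMost)
qed

lemma ln_Gamma_reflection:
  fixes t :: real
  assumes "0 < t" "t < 1"
  shows "ln (Gamma t) + ln (Gamma (1 - t)) = ln pi - ln (sin (pi * t))"
proof -
  have "complex_of_real (Gamma t * Gamma (1 - t)) = complex_of_real (pi / sin (pi * t))"
    using Gamma_reflection_complex[of "complex_of_real t"]
    by (simp flip: Gamma_complex_of_real sin_of_real)
  then have "Gamma t * Gamma (1 - t) = pi / sin (pi * t)"
    by (simp only: of_real_eq_iff)
  moreover have "sin (pi * t) > 0"
    using assms by (intro sin_gt_zero) auto
  ultimately have "ln (Gamma t * Gamma (1 - t)) = ln pi - ln (sin (pi * t))"
    by (simp add: ln_div)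
  then show ?thesis
    using assms by (simp add: ln_mult_pos)
qed

section \<open>Cauchy's formula for repeated integration\<close>

text \<open>Peels off the innermost integral instead of the outermost one, as the induction in Cauchy's
  formula needs.\<close>

lemma iterated_integral_right_shift:
  "iterated_integral_right b (Suc n) f x = iterated_integral_right b n (\<lambda>t. integral {t..b} f) x"
  by (induction n arbitrary: x) simp_all

text \<open>Induction with integration by parts: with \<open>F t = \<integral>\<^sub>t\<^sup>b f\<close>, integrating \<open>(t - a)\<^sup>n / n! F t\<close> moves
  the derivative from \<open>F\<close> onto the power.  Continuity of \<open>f\<close> is required only in the interior, so
  that \<open>f\<close> may have an integrable singularity at \<open>a\<close>.\<close>

lemma has_integral_iterated_integral_right:
  fixes f :: "real \<Rightarrow> real"
  assumes "a \<le> b" "continuous_on {a<..<b} f" "f integrable_on {a..b}"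
  shows "((\<lambda>t. (t - a) ^ n / fact n * f t) has_integral iterated_integral_right b (Suc n) f a) {a..b}"
  using assms(2,3)
proof (induction n arbitrary: f)
  case 0
  then show ?case
    by (simp add: has_integral_integral)
next
  case (Suc n)
  define F where "F = (\<lambda>t. integral {t..b} f)"
  have contF: "continuous_on {a..b} F"
    unfolding F_def by (intro indefinite_integral_continuous_1' Suc.prems)
  have derF: "(F has_real_derivative - f t) (at t)" if "t \<in> {a<..<b}" for t
  proof -
    have "((\<lambda>u. integral {a..u} f) has_vector_derivative f t) (at t within {a..b})"
      using that Suc.prems
      by (intro integral_has_vector_derivative_continuous_at[where S = "{}", simplified])
         (auto simp: continuous_on_eq_continuous_at intro: continuous_at_imp_continuous_at_within)
    then have "((\<lambda>u. integral {a..b} f - integral {a..u} f) has_real_derivative 0 - f t) (at t within {a..b})"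
      unfolding has_real_derivative_iff_has_vector_derivative[symmetric]
      by (intro DERIV_diff DERIV_const)
    then have "((\<lambda>u. integral {a..b} f - integral {a..u} f) has_real_derivative - f t) (at t)"
      using that by (simp add: at_within_Icc_at)
    moreover have "\<forall>\<^sub>F u in nhds t. u \<in> {a<..<b}"
      using that by (intro eventually_nhds_in_open) auto
    then have "\<forall>\<^sub>F u in nhds t. integral {a..b} f - integral {a..u} f = F u"
    proof eventually_elim
      case (elim u)
      then show ?case
        using Henstock_Kurzweil_Integration.integral_combine[of a u b f] Suc.prems by (simp add: F_def)
    qed
    ultimately show ?thesis
      by (subst (asm) DERIV_cong_ev[OF refl _ refl]) auto
  qed
  have "((\<lambda>t. (t - a) ^ n / fact n * F t) has_integral iterated_integral_right b (Suc n) F a) {a..b}"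
    by (intro Suc.IH integrable_continuous_real contF continuous_on_subset[OF contF]) auto
  also have "iterated_integral_right b (Suc n) F a = iterated_integral_right b (Suc (Suc n)) f a"
    by (simp only: iterated_integral_right_shift[of b "Suc n" f] F_def)
  finally have IH: "((\<lambda>t. (t - a) ^ n / fact n * F t) has_integral iterated_integral_right b (Suc (Suc n)) f a) {a..b}" .
  have derP: "((\<lambda>t. (t - a) ^ Suc n / fact (Suc n)) has_real_derivative (t - a) ^ n / fact n) (at t)" for t
  proof -
    have "((\<lambda>t. t - a) has_real_derivative 1) (at t)"
      by (auto intro!: derivative_eq_intros)
    from DERIV_chain2[OF _ this, OF DERIV_power_div_fact[of n "t - a"]] show ?thesis
      by simp
  qed
  have "((\<lambda>t. f t * ((t - a) ^ Suc n / fact (Suc n))) has_integral iterated_integral_right b (Suc (Suc n)) f a) {a..b}"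
  proof (rule integration_by_parts_interior[OF bounded_bilinear_mult \<open>a \<le> b\<close>,
        where f = "\<lambda>t. - F t" and g' = "\<lambda>t. (t - a) ^ n / fact n"])
    show "((\<lambda>t. - F t * ((t - a) ^ n / fact n)) has_integral
       - F b * ((b - a) ^ Suc n / fact (Suc n)) - - F a * ((a - a) ^ Suc n / fact (Suc n))
       - iterated_integral_right b (Suc (Suc n)) f a) {a..b}"
      using has_integral_neg[OF IH] by (simp add: F_def mult.commute)
  qed (use contF derF derP in \<open>auto intro!: continuous_intros DERIV_minus[THEN DERIV_cong]
         simp flip: has_real_derivative_iff_has_vector_derivative simp del: fact_Suc power_Suc\<close>)
  then show ?case
    by (simp add: mult.commute)
qed

text \<open>For integer order the complex power is the ordinary one except at \<open>t = x\<close>, where for \<open>m = 1\<close> it is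
  \<open>0\<close> instead of \<open>1\<close>; a single point does not affect the integral.\<close>

lemma rl_integral_right_of_nat:
  assumes "m \<ge> 1" "((\<lambda>t. (t - x) ^ (m - 1) / fact (m - 1) * f t) has_integral I) {x..b}"
  shows "rl_integral_right b (of_nat m) (\<lambda>t. complex_of_real (f t)) x = complex_of_real I"
proof -
  have G: "Gamma (of_nat m :: complex) = fact (m - 1)"
    using assms(1) Gamma_fact[of "m - 1", where 'a = complex] by (simp add: of_nat_diff)
  have pw: "complex_of_real (t - x) powr (of_nat m - 1) = complex_of_real ((t - x) ^ (m - 1))" if "t > x" for t
  proof -
    have "of_nat m - 1 = (of_nat (m - 1) :: complex)"
      using assms(1) by (simp add: of_nat_diff)
    then show ?thesis
      using that by (simp add: powr_nat' flip: of_real_diff)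
  qed
  have "((\<lambda>t. complex_of_real (t - x) powr (of_nat m - 1) * complex_of_real (f t)) has_integral
      complex_of_real (fact (m - 1) * I)) {x..b}"
  proof (rule has_integral_spike_finite[of "{x}"])
    show "((\<lambda>t. complex_of_real (fact (m - 1) * ((t - x) ^ (m - 1) / fact (m - 1) * f t))) has_integral
      complex_of_real (fact (m - 1) * I)) {x..b}"
      by (intro has_integral_of_real has_integral_mult_right assms)
  next
    show "complex_of_real (t - x) powr (of_nat m - 1) * complex_of_real (f t) =
        complex_of_real (fact (m - 1) * ((t - x) ^ (m - 1) / fact (m - 1) * f t))" if "t \<in> {x..b} - {x}" for t
      using that pw[of t] by simp
  qed auto
  from integral_unique[OF this] show ?thesis
    by (simp add: rl_integral_right_def G)
qed

section \<open>The iterated integral of the log-Gamma function\<close>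

lemma has_integral_power_ln_Gamma:
  assumes "m \<ge> 1"
  shows "((\<lambda>t. t ^ (m - 1) / fact (m - 1) * ln (Gamma t)) has_integral
    iterated_integral_right 1 m (\<lambda>t. ln (Gamma t)) 0) {0..1}"
proof -
  have "((\<lambda>t. (t - 0) ^ (m - 1) / fact (m - 1) * ln (Gamma t)) has_integral
      iterated_integral_right 1 (Suc (m - 1)) (\<lambda>t. ln (Gamma t)) 0) {0..1}"
  proof (rule has_integral_iterated_integral_right)
    show "continuous_on {0<..<1} (\<lambda>t::real. ln (Gamma t))"
      by (rule continuous_on_subset[OF continuous_on_ln_Gamma]) auto
    show "(\<lambda>t::real. ln (Gamma t)) integrable_on {0..1}"
      using has_integral_refl_bernpoly_ln_Gamma[of 0] by (auto simp: refl_bernpoly_0 integrable_on_def)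
  qed auto
  then show ?thesis
    using assms by simp
qed

theorem corollary2p1:
  fixes m :: nat
  assumes "m \<ge> 1"
  shows "rl_integral_right 1 (of_nat m) (\<lambda>t. complex_of_real (ln (Gamma t))) 0 =
           complex_of_real (iterated_integral_right 1 m (\<lambda>t. ln (Gamma t)) 0) \<and>
         iterated_integral_right 1 m (\<lambda>t. ln (Gamma t)) 0 =
           1 / fact m * (- (\<Sum>k = 0..m - 1. real (m choose k) * ln (glaisher_D k)) + ln pi
             - integral {0..1} (\<lambda>t. real m * t ^ (m - 1) * ln (sin (pi * t))))"
proof (intro conjI)
  let ?I = "iterated_integral_right 1 m (\<lambda>t. ln (Gamma t)) 0"
  let ?S = "\<Sum>k = 0..m - 1. real (m choose k) * ln (glaisher_D k)"
  note I = has_integral_power_ln_Gamma[OF assms]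
  show "rl_integral_right 1 (of_nat m) (\<lambda>t. complex_of_real (ln (Gamma t))) 0 = complex_of_real ?I"
    using I by (intro rl_integral_right_of_nat assms) simp
  have pi: "((\<lambda>t. real m * t ^ (m - 1) * ln pi) has_integral ln pi) {0..1}"
  proof -
    have "((\<lambda>t. real m * t ^ (m - 1)) has_integral 1 ^ m - 0 ^ m) {0..1::real}"
      by (rule fundamental_theorem_of_calculus)
         (auto simp flip: has_real_derivative_iff_has_vector_derivative intro!: derivative_eq_intros)
    from has_integral_mult_left[OF this, of "ln pi"] show ?thesis
      using assms by (simp add: power_0_left)
  qed
  have "((\<lambda>t. real m * t ^ (m - 1) * ln (sin (pi * t))) has_integral ln pi - fact m * ?I - ?S) {0..1}"
  proof (rule has_integral_spike_finite[of "{0, 1}"])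
    \<comment> \<open>the reflection formula, solved for \<open>ln sin\<close>; with the default
       values of \<open>ln\<close> and \<open>\<Gamma>\<close> at \<open>0\<close> it fails at the endpoints\<close>
    show "((\<lambda>t. real m * t ^ (m - 1) * ln pi - fact m * (t ^ (m - 1) / fact (m - 1) * ln (Gamma t))
        - real m * t ^ (m - 1) * ln (Gamma (1 - t))) has_integral ln pi - fact m * ?I - ?S) {0..1}"
      by (intro has_integral_diff has_integral_mult_right pi I
          has_integral_power_ln_Gamma_complement assms)
    fix t :: real assume t: "t \<in> {0..1} - {0, 1}"
    have "fact m * (t ^ (m - 1) / fact (m - 1) * ln (Gamma t)) = real m * t ^ (m - 1) * ln (Gamma t)"
      using assms by (simp add: fact_reduce[of m])
    moreover have "ln (sin (pi * t)) = ln pi - ln (Gamma t) - ln (Gamma (1 - t))"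
      using ln_Gamma_reflection[of t] t by simp
    ultimately show "real m * t ^ (m - 1) * ln (sin (pi * t)) =
        real m * t ^ (m - 1) * ln pi - fact m * (t ^ (m - 1) / fact (m - 1) * ln (Gamma t))
        - real m * t ^ (m - 1) * ln (Gamma (1 - t))"
      by (simp only: right_diff_distrib)
  qed auto
  then show "?I = 1 / fact m * (- ?S + ln pi - integral {0..1} (\<lambda>t. real m * t ^ (m - 1) * ln (sin (pi * t))))"
    by (simp add: integral_unique)
qed

end
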